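(* Let $\mathcal{H}=\mathcal{H}_{\mathfrak l}\otimes\mathcal{H}_{\mathfrak w}\otimes\mathcal{H}_{\mathfrak e}$ be finite-dimensional with Hamiltonian $H_\kappa=H+\kappa\,\mathbb{1}_{\mathfrak l}\otimes H_u\otimes\mathbb{1}_{\mathfrak e}$, where $H_u$ is non-degenerate, and let $|\hat w\rangle$ be an eigenstate of $H_u$. Consider initial states $\rho_0=\rho_{\mathfrak l}\otimes|\hat w\rangle\langle\hat w|\otimes\rho_{\mathfrak e}$, with $\rho(t)=e^{-\mathrm{i}H_\kappa t}\rho_0e^{\mathrm{i}H_\kappa t}$, purity $\gamma_{\mathfrak l}(t)=\mathrm{tr}\big((\mathrm{tr}_{\mathfrak{we}}\rho(t))^2\big)$ and $\gamma_0=\gamma_{\mathfrak l}(0)$. Let the index sets $\mathcal{C}_1$ (depending on $\kappa$), $\mathcal{K}_1$, $\mathcal{K}_2$ be as defined in the context. If $\mathcal{C}_1\cap\mathcal{K}_1\cap\mathcal{K}_2=\varnothing$ (for all sufficiently large $\kappa$), then for every $\epsilon>0$ there exists a $\kappa$ such that $$\gamma_{\mathfrak l}(t)\in(\gamma_0-\epsilon,\ \gamma_0+\epsilon)$$ for all times $t$ and for any initial density matrices $\rho_{\mathfrak l}$ on $\mathcal{H}_{\mathfrak l}$ and $\rho_{\mathfrak e}$ on $\mathcal{H}_{\mathfrak e}$.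
   Context: $H$ and $H_u$ are Hermitian. For each $\kappa$, let $|\psi_j^\kappa\rangle$ be an orthonormal eigenbasis of $H_\kappa$ with eigenvalues $\lambda_j^\kappa$, labelled and chosen so that the limits $|\tilde\psi_j\rangle=\lim_{\kappa\to\infty}|\psi_j^\kappa\rangle$ (asymptotic eigenstates) exist; each has the form $|\tilde\psi_j\rangle=\sum_{a,c}\alpha^{(j)}_{ac}|a\rangle|w_j\rangle|c\rangle$, where $\{|a\rangle\}$, $\{|c\rangle\}$ are orthonormal bases of $\mathcal{H}_{\mathfrak l}$, $\mathcal{H}_{\mathfrak e}$ and $|w_j\rangle$ is an eigenstate of $H_u$ (taken from a fixed orthonormal eigenbasis of $H_u$ containing $|\hat w\rangle$). Define $\lambda_{abij}=\lambda_a^\kappa-\lambda_b^\kappa+\lambda_i^\kappa-\lambda_j^\kappa$ and $$\mathcal{C}_1=\{(a,b,i,j):\lambda_{abij}\ne0\},$$ $$\mathcal{K}_1=\{(a,b,i,j):|w_a\rangle=|w_b\rangle=|w_i\rangle=|w_j\rangle=|\hat w\rangle\},$$ $$\mathcal{K}_2=\{(a,b,i,j):(\langle\tilde\psi_b|\otimes\langle\tilde\psi_j|)\,\mathrm{SWAP}_{\mathfrak{ll}}\,(|\tilde\psi_a\rangle\otimes|\tilde\psi_i\rangle)\ne0\},$$ where $\mathrm{SWAP}_{\mathfrak{ll}}$ on $\mathcal{H}\otimes\mathcal{H}$ swaps the two logical factors: $\mathrm{SWAP}_{\mathfrak{ll}}(|a\rangle|b\rangle|c\rangle\otimes|i\rangle|j\rangle|k\rangle)=|i\rangle|b\rangle|c\rangle\otimes|a\rangle|j\rangle|k\rangle$.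 *)

theory Defs
  imports "HOL-Analysis.Analysis"
begin

text \<open>
  Finite-dimensional Hilbert spaces are modelled as \<open>complex ^ 'n\<close>, operators as square complex
  matrices, and tensor products by product index types, so that
  \<open>H\<^sub>l \<otimes> (H\<^sub>w \<otimes> H\<^sub>e)\<close> is \<open>complex ^ ('l \<times> 'w \<times> 'e)\<close>. The library's \<open>\<bullet>\<close> on
  \<open>complex ^ 'n\<close> is the real inner product, whence \<open>cinner\<close> below.
\<close>

definition cinner :: "complex ^ 'n::finite \<Rightarrow> complex ^ 'n \<Rightarrow> complex" where
  "cinner x y = (\<Sum>i\<in>UNIV. cnj (x $ i) * y $ i)"

definition orthonormal_basis :: "('i \<Rightarrow> complex ^ 'n::finite) \<Rightarrow> bool" where
  "orthonormal_basis b \<longleftrightarrow>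
     (\<forall>i j. cinner (b i) (b j) = (if i = j then 1 else 0)) \<and> vec.span (range b) = UNIV"

definition hermitian :: "complex ^ 'n ^ 'n::finite \<Rightarrow> bool" where
  "hermitian A \<longleftrightarrow> (\<forall>i j. A $ i $ j = cnj (A $ j $ i))"

text \<open>Every eigenspace has complex dimension at most one.\<close>

definition nondegenerate :: "complex ^ 'n ^ 'n::finite \<Rightarrow> bool" where
  "nondegenerate A \<longleftrightarrow> (\<forall>\<mu>. vec.dim {x. A *v x = \<mu> *s x} \<le> 1)"

definition density_matrix :: "complex ^ 'n ^ 'n::finite \<Rightarrow> bool" where
  "density_matrix \<rho> \<longleftrightarrow>
     hermitian \<rho> \<and> (\<forall>x. 0 \<le> Re (cinner x (\<rho> *v x))) \<and> trace \<rho> = 1"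

definition tensor_vec ::
    "complex ^ 'm::finite \<Rightarrow> complex ^ 'n::finite \<Rightarrow> complex ^ ('m \<times> 'n)"
    (infixr "\<otimes>\<^sub>v" 75) where
  "x \<otimes>\<^sub>v y = (\<chi> p. x $ fst p * y $ snd p)"

definition tensor_mat ::
    "complex ^ 'm ^ 'm::finite \<Rightarrow> complex ^ 'n ^ 'n::finite \<Rightarrow> complex ^ ('m \<times> 'n) ^ ('m \<times> 'n)"
    (infixr "\<otimes>\<^sub>m" 75) where
  "A \<otimes>\<^sub>m B = (\<chi> p q. A $ fst p $ fst q * B $ snd p $ snd q)"

definition ketbra :: "complex ^ 'n::finite \<Rightarrow> complex ^ 'n \<Rightarrow> complex ^ 'n ^ 'n" where
  "ketbra x y = (\<chi> i j. x $ i * cnj (y $ j))"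

text \<open>Partial trace over the second tensor factor.\<close>

definition partial_trace ::
    "complex ^ ('m \<times> 'n) ^ ('m::finite \<times> 'n::finite) \<Rightarrow> complex ^ 'm ^ 'm" where
  "partial_trace \<rho> = (\<chi> i j. \<Sum>k\<in>UNIV. \<rho> $ (i, k) $ (j, k))"

text \<open>
  The exponential series; the library's \<open>exp\<close> does not apply, since square matrices are not an
  instance of \<open>real_normed_algebra_1\<close>. The \<open>n\<close>-th matrix power is \<open>((**) A ^^ n) (mat 1)\<close>.
\<close>

definition matrix_exp :: "complex ^ 'n ^ 'n::finite \<Rightarrow> complex ^ 'n ^ 'n" where
  "matrix_exp A = (\<Sum>n. (1 / fact n) *\<^sub>R ((**) A ^^ n) (mat 1))"

text \<open>\<open>mat c ** A\<close> is the scalar multiple of \<open>A\<close> by the complex number \<open>c\<close>.\<close>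

definition evolve ::
    "complex ^ 'n ^ 'n::finite \<Rightarrow> complex ^ 'n ^ 'n \<Rightarrow> real \<Rightarrow> complex ^ 'n ^ 'n" where
  "evolve H \<rho> t =
     matrix_exp (mat (- \<i> * of_real t) ** H) ** \<rho> ** matrix_exp (mat (\<i> * of_real t) ** H)"

text \<open>
  The trace is real for Hermitian arguments; \<open>Re\<close> only turns it into an element of \<open>real\<close>.
\<close>

definition purity :: "complex ^ 'n ^ 'n::finite \<Rightarrow> real" where
  "purity \<rho> = Re (trace (\<rho> ** \<rho>))"

definition H_total ::
    "complex ^ ('l \<times> 'w \<times> 'e) ^ ('l::finite \<times> 'w::finite \<times> 'e::finite) \<Rightarrow>
     complex ^ 'w ^ 'w \<Rightarrow> real \<Rightarrow> complex ^ ('l \<times> 'w \<times> 'e) ^ ('l \<times> 'w \<times> 'e)" where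
  "H_total H Hu \<kappa> = H + \<kappa> *\<^sub>R (mat 1 \<otimes>\<^sub>m Hu \<otimes>\<^sub>m mat 1)"

definition logical_purity ::
    "complex ^ ('l \<times> 'w \<times> 'e) ^ ('l::finite \<times> 'w::finite \<times> 'e::finite) \<Rightarrow>
     complex ^ 'w \<Rightarrow> complex ^ 'l ^ 'l \<Rightarrow> complex ^ 'e ^ 'e \<Rightarrow> real \<Rightarrow> real" where
  "logical_purity Htot what \<rho>l \<rho>e t =
     purity (partial_trace (evolve Htot (\<rho>l \<otimes>\<^sub>m ketbra what what \<otimes>\<^sub>m \<rho>e) t))"

definition swap_ll ::
    "complex ^ (('l::finite \<times> 'm::finite) \<times> ('l \<times> 'm)) \<Rightarrow> complex ^ (('l \<times> 'm) \<times> ('l \<times> 'm))" where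
  "swap_ll v = (\<chi> p. v $ ((fst (snd p), snd (fst p)), (fst (fst p), snd (snd p))))"

lemma swap_ll_tensor:
  "swap_ll ((a \<otimes>\<^sub>v b \<otimes>\<^sub>v c) \<otimes>\<^sub>v (i \<otimes>\<^sub>v j \<otimes>\<^sub>v k)) = (i \<otimes>\<^sub>v b \<otimes>\<^sub>v c) \<otimes>\<^sub>v (a \<otimes>\<^sub>v j \<otimes>\<^sub>v k)"
  by (simp add: swap_ll_def tensor_vec_def vec_eq_iff)

definition C1 :: "('j \<Rightarrow> real) \<Rightarrow> ('j \<times> 'j \<times> 'j \<times> 'j) set" where
  "C1 ev = {(a, b, i, j). ev a - ev b + ev i - ev j \<noteq> 0}"

definition K1 ::
    "('j \<Rightarrow> complex ^ 'w::finite) \<Rightarrow> complex ^ 'w \<Rightarrow> ('j \<times> 'j \<times> 'j \<times> 'j) set" where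
  "K1 w what = {(a, b, i, j). w a = what \<and> w b = what \<and> w i = what \<and> w j = what}"

definition K2 ::
    "('j \<Rightarrow> complex ^ ('l::finite \<times> 'm::finite)) \<Rightarrow> ('j \<times> 'j \<times> 'j \<times> 'j) set" where
  "K2 \<phi> = {(a, b, i, j). cinner (\<phi> b \<otimes>\<^sub>v \<phi> j) (swap_ll (\<phi> a \<otimes>\<^sub>v \<phi> i)) \<noteq> 0}"

end

theory Submission
  imports Defs
begin

text \<open>
  Expanding the evolved state in the eigenbasis of \<open>H\<^sub>\<kappa>\<close> gives
  \<open>\<gamma>(t) - \<gamma>(0) = \<Sum>\<^bsub>abij\<^esub> (exp (-\<i> \<lambda>\<^bsub>abij\<^esub> t) - 1) R\<^bsub>ab\<^esub> R\<^bsub>ij\<^esub> S\<^bsub>abij\<^esub>\<close>, where \<open>R\<close> holds the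
  matrix elements of \<open>\<rho>\<^sub>0\<close> and \<open>S\<close> those of the swap. Terms outside \<open>C\<^sub>1\<close> vanish; by
  hypothesis the others lie outside \<open>K\<^sub>1\<close> or outside \<open>K\<^sub>2\<close>. The modulus of
  \<open>R\<^bsub>ab\<^esub>\<close> is at most \<open>G\<^sub>a G\<^sub>b\<close>, with \<open>G\<close> the weight of an eigenvector in the sector of the prepared
  state, whatever \<open>\<rho>\<^sub>l\<close> and \<open>\<rho>\<^sub>e\<close> are. Outside \<open>K\<^sub>1\<close> some factor \<open>G\<close> tends to zero, and outside \<open>K\<^sub>2\<close>
  the factor \<open>S\<close> does; so these terms tend to zero uniformly in time and in the state.
\<close>

subsection \<open>Spectral calculus\<close>

text \<open>For an orthonormal basis \<open>b\<close>, the operator diagonal in \<open>b\<close>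
  with eigenvalues \<open>d\<close>. The label type of \<open>b\<close> is separate from the
  coordinate type because eigenstates carry their own labels.\<close>

definition spectral_mat :: "('j::finite \<Rightarrow> complex ^ 'n::finite) \<Rightarrow> ('j \<Rightarrow> complex) \<Rightarrow> complex ^ 'n ^ 'n" where
  "spectral_mat b d = (\<chi> p q. \<Sum>j\<in>UNIV. d j * b j $ p * cnj (b j $ q))"

lemma cinner_linear_right:
  "cinner x 0 = 0" "cinner x (y + z) = cinner x y + cinner x z" "cinner x (c *s y) = c * cinner x y"
  by (simp_all add: cinner_def sum.distrib sum_distrib_left algebra_simps)

lemma spectral_mat_vec:
  "spectral_mat b d *v x = (\<Sum>j\<in>UNIV. (d j * cinner (b j) x) *s b j)"
proof -
  have "(\<Sum>q\<in>UNIV. (\<Sum>j\<in>UNIV. d j * b j $ p * cnj (b j $ q)) * x $ q)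
      = (\<Sum>j\<in>UNIV. d j * (\<Sum>q\<in>UNIV. cnj (b j $ q) * x $ q) * b j $ p)" for p
    unfolding sum_distrib_right sum_distrib_left
    by (subst sum.swap) (simp add: mult_ac)
  then show ?thesis
    by (simp add: vec_eq_iff matrix_vector_mult_def spectral_mat_def cinner_def)
qed

text \<open>Both sides are linear in \<open>x\<close>, so induction over the span reduces the
  identity to basis vectors, where orthonormality leaves one term.\<close>

lemma orthonormal_basis_expansion:
  fixes b :: "'j::finite \<Rightarrow> complex ^ 'n::finite"
  assumes "orthonormal_basis b"
  shows "(\<Sum>j\<in>UNIV. cinner (b j) x *s b j) = x"
proof -
  have "x \<in> vec.span (range b)"
    using assms by (simp add: orthonormal_basis_def)
  then show ?thesis
  proof (induction rule: vec.span_induct_alt)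
    case base
    then show ?case by (simp add: cinner_linear_right)
  next
    case (step c x y)
    then obtain k where k: "x = b k" by auto
    have "(\<Sum>j\<in>UNIV. cinner (b j) (b k) *s b j) = (\<Sum>j\<in>UNIV. if j = k then b j else 0)"
      using assms by (intro sum.cong) (auto simp: orthonormal_basis_def)
    then have "(\<Sum>j\<in>UNIV. cinner (b j) (b k) *s b j) = b k" by simp
    then have "c *s (\<Sum>j\<in>UNIV. cinner (b j) (b k) *s b j) = c *s b k" by simp
    with step show ?case
      by (simp add: k cinner_linear_right vec.scale_left_distrib sum.distrib vec.scale_sum_right)
  qed
qed

lemma spectral_mat_vec_basis:
  assumes "orthonormal_basis b"
  shows "spectral_mat b d *v b k = d k *s b k"
proof -
  have "(\<Sum>j\<in>UNIV. (d j * cinner (b j) (b k)) *s b j) = (\<Sum>j\<in>UNIV. if j = k then d j *s b j else 0)"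
    using assms by (intro sum.cong) (auto simp: orthonormal_basis_def)
  then show ?thesis by (simp add: spectral_mat_vec)
qed

lemma matrix_eq_on_orthonormal_basis:
  fixes A B :: "complex ^ 'n::finite ^ 'n" and b :: "'j::finite \<Rightarrow> complex ^ 'n"
  assumes "orthonormal_basis b" "\<And>j. A *v b j = B *v b j"
  shows "A = B"
proof -
  have "A *v x = B *v x" for x
  proof -
    have "A *v (\<Sum>j\<in>UNIV. cinner (b j) x *s b j) = B *v (\<Sum>j\<in>UNIV. cinner (b j) x *s b j)"
      by (simp add: vec.linear_sum[OF matrix_vector_mul_linear_gen]
          vec.linear_scale[OF matrix_vector_mul_linear_gen] assms(2))
    then show ?thesis by (simp add: orthonormal_basis_expansion[OF assms(1)])
  qed
  then show ?thesis by (simp add: matrix_eq)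
qed

lemma matrix_power_vec_eigenvector:
  fixes A :: "complex ^ 'n::finite ^ 'n"
  assumes "A *v x = \<mu> *s x"
  shows "((**) A ^^ n) (mat 1) *v x = \<mu> ^ n *s x"
  by (induction n)
    (simp_all add: matrix_vector_mul_assoc[symmetric] vec.linear_scale[OF matrix_vector_mul_linear_gen]
      assms mult.commute)

text \<open>Every power of \<open>A\<close> is diagonal in \<open>b\<close>, with eigenvalues
  \<open>\<mu> j ^ n\<close>. Each entry of the exponential series is then a finite combination of
  scalar exponential series, so convergence can be checked entry by entry.\<close>

lemma matrix_exp_eq_spectral_mat:
  fixes A :: "complex ^ 'n::finite ^ 'n"
  assumes b: "orthonormal_basis b" and A: "\<And>j. A *v b j = \<mu> j *s b j"
  shows "matrix_exp A = spectral_mat b (\<lambda>j. exp (\<mu> j))"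
proof -
  have pow: "((**) A ^^ n) (mat 1) = spectral_mat b (\<lambda>j. \<mu> j ^ n)" for n
    by (rule matrix_eq_on_orthonormal_basis[OF b])
      (simp add: matrix_power_vec_eigenvector A spectral_mat_vec_basis b)
  have "(\<lambda>n. \<Sum>j\<in>UNIV. (\<mu> j ^ n /\<^sub>R fact n) * b j $ p * cnj (b j $ q)) sums
      (\<Sum>j\<in>UNIV. exp (\<mu> j) * b j $ p * cnj (b j $ q))" for p q
    by (intro sums_sum sums_mult2 exp_converges)
  moreover have "((1 / fact n) *\<^sub>R spectral_mat b (\<lambda>j. \<mu> j ^ n)) $ p $ q
      = (\<Sum>j\<in>UNIV. (\<mu> j ^ n /\<^sub>R fact n) * b j $ p * cnj (b j $ q))" for n p q
    by (simp add: spectral_mat_def scaleR_sum_right divide_inverse)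
  ultimately have "(\<lambda>n. (1 / fact n) *\<^sub>R spectral_mat b (\<lambda>j. \<mu> j ^ n)) sums
      spectral_mat b (\<lambda>j. exp (\<mu> j))"
    unfolding sums_def by (intro vec_tendstoI) (simp add: spectral_mat_def)
  then show ?thesis
    unfolding matrix_exp_def pow by (simp add: sums_iff)
qed

lemma mat_times_eigenvector:
  fixes A :: "complex ^ 'n::finite ^ 'n"
  assumes "A *v x = \<mu> *s x"
  shows "(mat c ** A) *v x = (c * \<mu>) *s x"
proof -
  have "mat c *v y = c *s y" for y :: "complex ^ 'n"
    by (simp add: vec_eq_iff matrix_vector_mult_def mat_def if_distrib if_distribR sum.delta cong: if_cong)
  then show ?thesis
    by (simp add: matrix_vector_mul_assoc[symmetric] assms)
qed

lemma sum_swap_pairs: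
  "(\<Sum>a\<in>A. \<Sum>b\<in>B. \<Sum>c\<in>C. \<Sum>d\<in>D. f a b c d) = (\<Sum>c\<in>C. \<Sum>d\<in>D. \<Sum>a\<in>A. \<Sum>b\<in>B. f a b c d)"
proof -
  have "(\<Sum>a\<in>A. \<Sum>b\<in>B. \<Sum>c\<in>C. \<Sum>d\<in>D. f a b c d) = (\<Sum>a\<in>A. \<Sum>c\<in>C. \<Sum>b\<in>B. \<Sum>d\<in>D. f a b c d)"
    by (rule sum.cong[OF refl], rule sum.swap)
  also have "\<dots> = (\<Sum>c\<in>C. \<Sum>a\<in>A. \<Sum>d\<in>D. \<Sum>b\<in>B. f a b c d)"
    by (subst sum.swap, rule sum.cong[OF refl], rule sum.cong[OF refl], rule sum.swap)
  also have "\<dots> = (\<Sum>c\<in>C. \<Sum>d\<in>D. \<Sum>a\<in>A. \<Sum>b\<in>B. f a b c d)"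
    by (rule sum.cong[OF refl], rule sum.swap)
  finally show ?thesis .
qed

text \<open>Both propagators are diagonal in \<open>b\<close>, so the evolution only multiplies each
  matrix element of \<open>\<rho>\<close> in this basis by a phase whose frequency is a difference
  of two eigenvalues.\<close>

lemma evolve_entry:
  fixes \<rho> :: "complex ^ 'n::finite ^ 'n" and b :: "'j::finite \<Rightarrow> complex ^ 'n"
  assumes b: "orthonormal_basis b" and A: "\<And>j. A *v b j = complex_of_real (l j) *s b j"
  shows "evolve A \<rho> t $ p $ q = (\<Sum>a\<in>UNIV. \<Sum>c\<in>UNIV.
    exp (- \<i> * t * (l a - l c)) * cinner (b a) (\<rho> *v b c) * b a $ p * cnj (b c $ q))"
proof -
  let ?e = "\<lambda>s j. exp (s * complex_of_real (l j))"
  have U: "matrix_exp (mat s ** A) = spectral_mat b (?e s)" for s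
    by (rule matrix_exp_eq_spectral_mat[OF b mat_times_eigenvector[OF A]])
  have "(spectral_mat b d ** \<rho> ** spectral_mat b d') $ p $ q
      = (\<Sum>a\<in>UNIV. \<Sum>c\<in>UNIV. d a * d' c * cinner (b a) (\<rho> *v b c) * b a $ p * cnj (b c $ q))" for d d'
  proof -
    have "(spectral_mat b d ** \<rho> ** spectral_mat b d') $ p $ q
       = (\<Sum>s\<in>UNIV. \<Sum>r\<in>UNIV. \<Sum>c\<in>UNIV. \<Sum>a\<in>UNIV.
           d a * b a $ p * cnj (b a $ r) * \<rho> $ r $ s * (d' c * b c $ s * cnj (b c $ q)))"
      unfolding matrix_matrix_mult_def spectral_mat_def
      by (simp add: sum_distrib_left sum_distrib_right)
        (rule sum.cong[OF refl], rule sum.swap)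
    also have "\<dots> = (\<Sum>c\<in>UNIV. \<Sum>a\<in>UNIV. \<Sum>s\<in>UNIV. \<Sum>r\<in>UNIV.
           d a * b a $ p * cnj (b a $ r) * \<rho> $ r $ s * (d' c * b c $ s * cnj (b c $ q)))"
      by (rule sum_swap_pairs)
    also have "\<dots> = (\<Sum>a\<in>UNIV. \<Sum>c\<in>UNIV. \<Sum>r\<in>UNIV. \<Sum>s\<in>UNIV.
           d a * b a $ p * cnj (b a $ r) * \<rho> $ r $ s * (d' c * b c $ s * cnj (b c $ q)))"
      by (subst sum.swap, rule sum.cong[OF refl], rule sum.cong[OF refl], rule sum.swap)
    finally show ?thesis
      by (simp add: cinner_def matrix_vector_mult_def sum_distrib_left sum_distrib_right mult_ac)
  qed
  then have "evolve A \<rho> t $ p $ q = (\<Sum>a\<in>UNIV. \<Sum>c\<in>UNIV. ?e (- \<i> * t) a * ?e (\<i> * t) c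
      * cinner (b a) (\<rho> *v b c) * b a $ p * cnj (b c $ q))"
    by (simp add: evolve_def U)
  moreover have "?e (- \<i> * t) a * ?e (\<i> * t) c = exp (- \<i> * t * (l a - l c))" for a c
    by (simp add: exp_add[symmetric] algebra_simps)
  ultimately show ?thesis by simp
qed

subsection \<open>Purity and the swap operator\<close>

lemma sum_UNIV_prod: "(\<Sum>p\<in>UNIV. f p) = (\<Sum>x\<in>UNIV. \<Sum>y\<in>UNIV. f (x, y))"
  by (simp add: sum.cartesian_product)

text \<open>The swap trick: the trace of a product of two reduced operators is the trace of the swap
  of the logical factors times their tensor product, here for operators of rank at most one.\<close>

lemma trace_partial_trace_ketbra:
  fixes x y x' y' :: "complex ^ ('l::finite \<times> 'm::finite)"
  shows "trace (partial_trace (ketbra x y) ** partial_trace (ketbra x' y'))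
    = cinner (y \<otimes>\<^sub>v y') (swap_ll (x \<otimes>\<^sub>v x'))"
proof -
  let ?f = "\<lambda>l l' m m'. x $ (l, m) * cnj (y $ (l', m)) * (x' $ (l', m') * cnj (y' $ (l, m')))"
  have "trace (partial_trace (ketbra x y) ** partial_trace (ketbra x' y'))
      = (\<Sum>l\<in>UNIV. \<Sum>l'\<in>UNIV. \<Sum>m\<in>UNIV. \<Sum>m'\<in>UNIV. ?f l l' m m')"
    by (simp add: trace_def matrix_matrix_mult_def partial_trace_def ketbra_def sum_product)
  also have "\<dots> = (\<Sum>l'\<in>UNIV. \<Sum>l\<in>UNIV. \<Sum>m\<in>UNIV. \<Sum>m'\<in>UNIV. ?f l l' m m')"
    by (rule sum.swap)
  also have "\<dots> = (\<Sum>l'\<in>UNIV. \<Sum>m\<in>UNIV. \<Sum>l\<in>UNIV. \<Sum>m'\<in>UNIV. ?f l l' m m')"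
    by (rule sum.cong[OF refl], rule sum.swap)
  also have "\<dots> = cinner (y \<otimes>\<^sub>v y') (swap_ll (x \<otimes>\<^sub>v x'))"
    by (simp add: cinner_def swap_ll_def tensor_vec_def sum_UNIV_prod mult_ac)
  finally show ?thesis .
qed

text \<open>The partial trace is linear and the trace of a product bilinear, so squaring a double
  expansion in \<open>ketbra (x a) (x b)\<close> gives a fourfold one, weighted by the swap elements
  that define \<open>K2\<close>.\<close>

lemma trace_partial_trace_square:
  fixes x :: "'j::finite \<Rightarrow> complex ^ ('l::finite \<times> 'm::finite)"
  assumes "\<And>p q. \<rho> $ p $ q = (\<Sum>a\<in>UNIV. \<Sum>b\<in>UNIV. c a b * x a $ p * cnj (x b $ q))"
  shows "trace (partial_trace \<rho> ** partial_trace \<rho>) =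
    (\<Sum>(a, b, i, j)\<in>UNIV. c a b * c i j * cinner (x b \<otimes>\<^sub>v x j) (swap_ll (x a \<otimes>\<^sub>v x i)))"
proof -
  define M where "M = (\<lambda>a b. partial_trace (ketbra (x a) (x b)))"
  have pt: "partial_trace \<rho> $ l $ l' = (\<Sum>(a, b)\<in>UNIV. c a b * M a b $ l $ l')" for l l'
  proof -
    have "partial_trace \<rho> $ l $ l'
        = (\<Sum>m\<in>UNIV. \<Sum>(a, b)\<in>UNIV. c a b * x a $ (l, m) * cnj (x b $ (l', m)))"
      by (simp add: partial_trace_def assms sum_UNIV_prod)
    also have "\<dots> = (\<Sum>(a, b)\<in>UNIV. \<Sum>m\<in>UNIV. c a b * x a $ (l, m) * cnj (x b $ (l', m)))"
      by (subst sum.swap) (simp add: case_prod_unfold)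
    finally show ?thesis
      by (simp add: M_def partial_trace_def ketbra_def sum_distrib_left mult_ac)
  qed
  have "trace (partial_trace \<rho> ** partial_trace \<rho>) = (\<Sum>l\<in>UNIV. \<Sum>l'\<in>UNIV. \<Sum>P\<in>UNIV. \<Sum>Q\<in>UNIV.
      c (fst P) (snd P) * M (fst P) (snd P) $ l $ l' * (c (fst Q) (snd Q) * M (fst Q) (snd Q) $ l' $ l))"
    by (simp add: trace_def matrix_matrix_mult_def pt sum_product case_prod_unfold)
  also have "\<dots> = (\<Sum>P\<in>UNIV. \<Sum>Q\<in>UNIV. \<Sum>l\<in>UNIV. \<Sum>l'\<in>UNIV.
      c (fst P) (snd P) * M (fst P) (snd P) $ l $ l' * (c (fst Q) (snd Q) * M (fst Q) (snd Q) $ l' $ l))"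
    by (rule sum_swap_pairs)
  also have "\<dots> = (\<Sum>P\<in>UNIV. \<Sum>Q\<in>UNIV. c (fst P) (snd P) * c (fst Q) (snd Q) *
      trace (M (fst P) (snd P) ** M (fst Q) (snd Q)))"
    by (simp add: trace_def matrix_matrix_mult_def sum_distrib_left mult_ac)
  finally show ?thesis
    by (simp add: M_def trace_partial_trace_ketbra sum_UNIV_prod)
qed

subsection \<open>Bounds uniform in the initial state\<close>

lemma cinner_axis_mult: "cinner (axis i a) (A *v axis j b) = cnj a * A $ i $ j * b"
proof -
  have "(A *v axis j b) $ k = A $ k $ j * b" for k
    by (simp add: matrix_vector_mult_def axis_def if_distrib cong: if_cong)
  then show ?thesis
    by (simp add: cinner_def) (simp add: axis_def if_distrib if_distribR mult_ac cong: if_cong)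
qed

lemma cinner_linear_left: "cinner (x + y) z = cinner x z + cinner y z"
  by (simp add: cinner_def sum.distrib algebra_simps)

text \<open>Positivity on a vector supported on the coordinates \<open>i\<close> and
  \<open>j\<close> bounds twice the modulus of the entry by the sum of two diagonal entries, each at
  most 1 by the trace condition. This is the source of uniformity in the initial state.\<close>

lemma density_matrix_entry_le_1:
  assumes "density_matrix \<rho>"
  shows "norm (\<rho> $ i $ j) \<le> 1"
proof -
  have herm: "\<rho> $ i $ j = cnj (\<rho> $ j $ i)" for i j
    using assms unfolding density_matrix_def hermitian_def by blast
  have psd: "0 \<le> Re (cinner x (\<rho> *v x))" for x
    using assms by (simp add: density_matrix_def)
  have diag: "0 \<le> Re (\<rho> $ k $ k)" for k
    using psd[of "axis k 1"] by (simp add: cinner_axis_mult)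
  have "(\<Sum>k\<in>UNIV. Re (\<rho> $ k $ k)) = 1"
    using assms by (simp add: density_matrix_def trace_def flip: Re_sum)
  then have le1: "Re (\<rho> $ k $ k) \<le> 1" for k
    using member_le_sum[of k UNIV "\<lambda>k. Re (\<rho> $ k $ k)"] diag by simp
  show ?thesis
  proof (cases "\<rho> $ i $ j = 0")
    case False
    \<comment> \<open>The phase of the entry: in the test vector
      \<open>axis i s + axis j (-1)\<close> it turns both cross terms into
      \<open>- norm (\<rho> $ i $ j)\<close>.\<close>
    define s where "s = sgn (\<rho> $ i $ j)"
    have ns: "s * cnj s = 1"
      using False by (simp add: s_def complex_norm_square[symmetric] norm_sgn)
    have "\<rho> $ i $ j = norm (\<rho> $ i $ j) * s"
      using False by (simp add: s_def sgn_eq)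
    then have s: "cnj s * \<rho> $ i $ j = norm (\<rho> $ i $ j)"
      using ns by (metis mult.assoc mult.commute mult.right_neutral)
    have s': "s * \<rho> $ j $ i = norm (\<rho> $ i $ j)"
      using arg_cong[OF s, of cnj] by (simp add: herm[of j i])
    have "cinner (axis i s + axis j (-1)) (\<rho> *v (axis i s + axis j (-1)))
        = (s * cnj s) * \<rho> $ i $ i + \<rho> $ j $ j - cnj s * \<rho> $ i $ j - s * \<rho> $ j $ i"
      by (simp add: matrix_vector_right_distrib cinner_linear_left cinner_linear_right cinner_axis_mult)
    then have "0 \<le> Re (\<rho> $ i $ i) + Re (\<rho> $ j $ j) - 2 * norm (\<rho> $ i $ j)"
      using psd[of "axis i s + axis j (-1)"] by (simp add: ns s s')
    with le1[of i] le1[of j] show ?thesis by linarith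
  qed simp
qed

text \<open>The l1 norm of the partial inner product of \<open>v\<close> with \<open>x\<close>. A
  sum of moduli, rather than a Euclidean norm, fits the entrywise bound on density matrices.\<close>

definition sector_weight ::
    "complex ^ 'w::finite \<Rightarrow> complex ^ ('l::finite \<times> 'w \<times> 'e::finite) \<Rightarrow> real" where
  "sector_weight v x = (\<Sum>l\<in>UNIV. \<Sum>e\<in>UNIV. norm (\<Sum>k\<in>UNIV. cnj (v $ k) * x $ (l, k, e)))"

lemma sector_weight_nonneg: "0 \<le> sector_weight v x"
  by (simp add: sector_weight_def sum_nonneg)

text \<open>The factor \<open>ketbra v v\<close> contracts the middle index of both vectors with
  \<open>v\<close>. What remains is a sesquilinear form in the contracted vectors whose coefficients
  are products of density matrix entries.\<close>

lemma initial_state_element_bound: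
  fixes x y :: "complex ^ ('l::finite \<times> 'w::finite \<times> 'e::finite)"
  assumes "density_matrix \<rho>l" "density_matrix \<rho>e"
  shows "norm (cinner x ((\<rho>l \<otimes>\<^sub>m ketbra v v \<otimes>\<^sub>m \<rho>e) *v y)) \<le> sector_weight v x * sector_weight v y"
proof -
  define g where "g = (\<lambda>z (P :: 'l \<times> 'e). \<Sum>k\<in>UNIV. cnj (v $ k) * z $ (fst P, k, snd P))"
  define D where "D = (\<lambda>P Q. \<rho>l $ fst P $ fst Q * \<rho>e $ snd P $ snd Q)"
  have sw: "sector_weight v z = (\<Sum>P\<in>UNIV. norm (g z P))" for z
    by (simp add: sector_weight_def g_def sum_UNIV_prod)
  \<comment> \<open>Regrouping the indices puts the sum over the middle factor innermost, where it
    becomes the contraction \<open>g\<close>.\<close>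
  have split: "(\<Sum>p\<in>UNIV. f p) = (\<Sum>P\<in>UNIV. \<Sum>k\<in>UNIV. f (fst P, k, snd P))"
    for f :: "'l \<times> 'w \<times> 'e \<Rightarrow> complex"
    by (simp add: sum_UNIV_prod) (rule sum.cong[OF refl], rule sum.swap)
  have "cinner x ((\<rho>l \<otimes>\<^sub>m ketbra v v \<otimes>\<^sub>m \<rho>e) *v y) = (\<Sum>P\<in>UNIV. \<Sum>k\<in>UNIV. \<Sum>Q\<in>UNIV. \<Sum>k'\<in>UNIV.
      D P Q * (v $ k * cnj (x $ (fst P, k, snd P))) * (cnj (v $ k') * y $ (fst Q, k', snd Q)))"
    by (simp add: cinner_def matrix_vector_mult_def split tensor_mat_def ketbra_def D_def
        sum_distrib_left mult_ac)
  also have "\<dots> = (\<Sum>P\<in>UNIV. \<Sum>Q\<in>UNIV. \<Sum>k\<in>UNIV. \<Sum>k'\<in>UNIV.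
      D P Q * (v $ k * cnj (x $ (fst P, k, snd P))) * (cnj (v $ k') * y $ (fst Q, k', snd Q)))"
    by (rule sum.cong[OF refl], rule sum.swap)
  also have "\<dots> = (\<Sum>P\<in>UNIV. \<Sum>Q\<in>UNIV. D P Q * cnj (g x P) * g y Q)"
    by (simp add: g_def sum_distrib_left sum_distrib_right mult_ac)
  finally have eq: "cinner x ((\<rho>l \<otimes>\<^sub>m ketbra v v \<otimes>\<^sub>m \<rho>e) *v y)
      = (\<Sum>P\<in>UNIV. \<Sum>Q\<in>UNIV. D P Q * cnj (g x P) * g y Q)" .
  have D: "norm (D P Q) \<le> 1" for P Q
    by (simp add: D_def norm_mult mult_le_one density_matrix_entry_le_1 assms)
  have "norm (\<Sum>P\<in>UNIV. \<Sum>Q\<in>UNIV. D P Q * cnj (g x P) * g y Q)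
      \<le> (\<Sum>P\<in>UNIV. \<Sum>Q\<in>UNIV. norm (g x P) * norm (g y Q))"
    by (intro sum_norm_le)
      (simp add: norm_mult mult_left_le_one_le D mult.assoc)
  then show ?thesis
    unfolding eq sw sum_product .
qed

text \<open>Contracting with \<open>v\<close> produces the factor \<open>cinner v w\<close> in every
  component.\<close>

lemma sector_weight_product_zero:
  fixes \<alpha> :: "'l::finite \<Rightarrow> 'e::finite \<Rightarrow> complex"
  assumes "cinner v w = 0"
  shows "sector_weight v (\<Sum>a\<in>UNIV. \<Sum>c\<in>UNIV. \<alpha> a c *s (axis a 1 \<otimes>\<^sub>v w \<otimes>\<^sub>v axis c 1)) = 0"
proof -
  have "(\<Sum>a\<in>UNIV. \<Sum>c\<in>UNIV. \<alpha> a c *s (axis a 1 \<otimes>\<^sub>v w \<otimes>\<^sub>v axis c 1)) $ (l, k, e) = \<alpha> l e * w $ k" for l k e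
  proof -
    have "\<alpha> a c * (axis a 1 $ l * (w $ k * axis c 1 $ e))
        = (if c = e then if a = l then \<alpha> a c * w $ k else 0 else 0)" for a c
      by (auto simp: axis_def)
    then show ?thesis by (simp add: tensor_vec_def)
  qed
  moreover have "(\<Sum>k\<in>UNIV. cnj (v $ k) * (\<alpha> l e * w $ k)) = \<alpha> l e * cinner v w" for l e
    by (simp add: cinner_def sum_distrib_left mult_ac)
  ultimately show ?thesis
    by (simp add: sector_weight_def assms)
qed

section \<open>Continuity in the eigenvectors\<close>

lemma tendsto_sector_weight:
  assumes "(f \<longlongrightarrow> x) F"
  shows "((\<lambda>s. sector_weight v (f s)) \<longlongrightarrow> sector_weight v x) F"
  unfolding sector_weight_def by (intro tendsto_intros tendsto_vec_nth assms)

lemma tendsto_swap_element: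
  fixes x y x' y' :: "'s \<Rightarrow> complex ^ ('l::finite \<times> 'm::finite)"
  assumes "(x \<longlongrightarrow> X) F" "(y \<longlongrightarrow> Y) F" "(x' \<longlongrightarrow> X') F" "(y' \<longlongrightarrow> Y') F"
  shows "((\<lambda>s. cinner (y s \<otimes>\<^sub>v y' s) (swap_ll (x s \<otimes>\<^sub>v x' s))) \<longlongrightarrow>
    cinner (Y \<otimes>\<^sub>v Y') (swap_ll (X \<otimes>\<^sub>v X'))) F"
  unfolding cinner_def swap_ll_def tensor_vec_def
  by (simp, intro tendsto_intros tendsto_vec_nth assms)

text \<open>Majorant of the time-independent part of one term in the purity expansion. It involves
  neither time nor the density matrices and is continuous in the eigenvectors.\<close>

definition coherence_bound ::
    "complex ^ 'w::finite \<Rightarrow> ('j \<Rightarrow> complex ^ ('l::finite \<times> 'w \<times> 'e::finite)) \<Rightarrow> 'j \<times> 'j \<times> 'j \<times> 'j \<Rightarrow> real" where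
  "coherence_bound v x = (\<lambda>(a, b, i, j).
     sector_weight v (x a) * sector_weight v (x b) * (sector_weight v (x i) * sector_weight v (x j))
     * norm (cinner (x b \<otimes>\<^sub>v x j) (swap_ll (x a \<otimes>\<^sub>v x i))))"

lemma coherence_bound_nonneg: "0 \<le> coherence_bound v x J"
  by (cases J) (simp add: coherence_bound_def sector_weight_nonneg)

lemma tendsto_coherence_bound:
  assumes "\<And>j. ((\<lambda>s. x s j) \<longlongrightarrow> X j) F"
  shows "((\<lambda>s. coherence_bound v (x s) J) \<longlongrightarrow> coherence_bound v X J) F"
  by (cases J) (simp add: coherence_bound_def,
      intro tendsto_intros tendsto_sector_weight tendsto_swap_element assms)

section \<open>Deviation of the purity at fixed coupling\<close>

lemma logical_purity_diff_bound:
  fixes b :: "'j::finite \<Rightarrow> complex ^ ('l::finite \<times> 'w::finite \<times> 'e::finite)"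
  assumes b: "orthonormal_basis b" and A: "\<And>j. A *v b j = complex_of_real (lam j) *s b j"
    and "density_matrix \<rho>l" "density_matrix \<rho>e"
  shows "\<bar>logical_purity A v \<rho>l \<rho>e t - logical_purity A v \<rho>l \<rho>e 0\<bar>
    \<le> 2 * (\<Sum>J\<in>C1 lam. coherence_bound v b J)"
proof -
  define \<rho> where "\<rho> = \<rho>l \<otimes>\<^sub>m ketbra v v \<otimes>\<^sub>m \<rho>e"
  define R where "R = (\<lambda>a c. cinner (b a) (\<rho> *v b c))"
  define S where "S = (\<lambda>a c i j. cinner (b c \<otimes>\<^sub>v b j) (swap_ll (b a \<otimes>\<^sub>v b i)))"
  \<comment> \<open>The exponent is \<open>\<i>\<close> times a real number, so the phase has
    modulus 1; its frequency is the combination tested in \<open>C1\<close>.\<close>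
  define ph where "ph = (\<lambda>t a c i j. exp (\<i> * complex_of_real (- t * (lam a - lam c + lam i - lam j))))"
  have ph_mult: "exp (- \<i> * t * (lam a - lam c)) * exp (- \<i> * t * (lam i - lam j)) = ph t a c i j"
    for t a c i j
    by (simp add: ph_def exp_add[symmetric] algebra_simps)
  have lp: "logical_purity A v \<rho>l \<rho>e t
      = Re (\<Sum>(a, c, i, j)\<in>UNIV. ph t a c i j * (R a c * R i j * S a c i j))" for t
  proof -
    have "trace (partial_trace (evolve A \<rho> t) ** partial_trace (evolve A \<rho> t))
        = (\<Sum>(a, c, i, j)\<in>UNIV. exp (- \<i> * t * (lam a - lam c)) * R a c *
            (exp (- \<i> * t * (lam i - lam j)) * R i j) * S a c i j)"
      unfolding S_def
      by (rule trace_partial_trace_square) (simp add: evolve_entry[OF b A] R_def)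
    also have "\<dots> = (\<Sum>(a, c, i, j)\<in>UNIV. ph t a c i j * (R a c * R i j * S a c i j))"
      by (intro sum.cong refl) (auto simp: ph_mult[symmetric] mult_ac)
    finally show ?thesis
      by (simp add: logical_purity_def purity_def \<rho>_def)
  qed
  have ph_eq_1: "ph t a c i j = 1" if "(a, c, i, j) \<notin> C1 lam" for a c i j
  proof -
    from that have "lam a - lam c + lam i - lam j = 0" by (simp add: C1_def)
    then show ?thesis by (simp only: ph_def) simp
  qed
  \<comment> \<open>At time zero every phase is 1, which leaves the factor
    \<open>ph t a c i j - 1\<close> in the difference of the two expansions.\<close>
  have "logical_purity A v \<rho>l \<rho>e t - logical_purity A v \<rho>l \<rho>e 0
      = Re (\<Sum>(a, c, i, j)\<in>UNIV. (ph t a c i j - 1) * (R a c * R i j * S a c i j))"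
    unfolding lp Re_sum[symmetric] minus_complex.sel(1)[symmetric] sum_subtractf[symmetric]
    by (intro arg_cong[where f = Re] sum.cong refl) (auto simp: ph_def algebra_simps)
  \<comment> \<open>Resonant quadruples keep the phase 1 at all times and drop out.\<close>
  also have "\<dots> = Re (\<Sum>(a, c, i, j)\<in>C1 lam. (ph t a c i j - 1) * (R a c * R i j * S a c i j))"
    by (intro arg_cong[where f = Re] sum.mono_neutral_right) (auto simp: ph_eq_1)
  finally have diff: "logical_purity A v \<rho>l \<rho>e t - logical_purity A v \<rho>l \<rho>e 0
      = Re (\<Sum>(a, c, i, j)\<in>C1 lam. (ph t a c i j - 1) * (R a c * R i j * S a c i j))" .
  have R: "norm (R a c) \<le> sector_weight v (b a) * sector_weight v (b c)" for a c
    unfolding R_def \<rho>_def by (rule initial_state_element_bound[OF assms(3,4)])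
  have ph: "norm (ph t a c i j - 1) \<le> 2" for a c i j
    using norm_triangle_ineq4[of "ph t a c i j" 1] unfolding ph_def norm_exp_i_times by simp
  have "norm ((ph t a c i j - 1) * (R a c * R i j * S a c i j)) \<le> 2 * coherence_bound v b (a, c, i, j)"
    for a c i j
    unfolding norm_mult coherence_bound_def prod.case S_def
    by (intro mult_mono ph R order_refl) (simp_all add: sector_weight_nonneg)
  then have "norm (\<Sum>(a, c, i, j)\<in>C1 lam. (ph t a c i j - 1) * (R a c * R i j * S a c i j))
      \<le> (\<Sum>J\<in>C1 lam. 2 * coherence_bound v b J)"
    by (intro sum_norm_le) auto
  then show ?thesis
    unfolding diff sum_distrib_left using abs_Re_le_cmod order_trans by blast
qed

section \<open>The limit of strong coupling\<close>

theorem proposition6: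
  fixes H :: "complex ^ ('l::finite \<times> 'w::finite \<times> 'e::finite) ^ ('l \<times> 'w \<times> 'e)"
    and Hu :: "complex ^ 'w ^ 'w"
    and u :: "'k::finite \<Rightarrow> complex ^ 'w"
    and what :: "complex ^ 'w"
    and \<psi> :: "real \<Rightarrow> 'j::finite \<Rightarrow> complex ^ ('l \<times> 'w \<times> 'e)"
    and ev :: "real \<Rightarrow> 'j \<Rightarrow> real"
    and \<phi> :: "'j \<Rightarrow> complex ^ ('l \<times> 'w \<times> 'e)"
    and \<alpha> :: "'j \<Rightarrow> 'l \<Rightarrow> 'e \<Rightarrow> complex"
    and w :: "'j \<Rightarrow> complex ^ 'w"
  assumes "hermitian H"
    and "hermitian Hu"
    and "nondegenerate Hu"
    and "orthonormal_basis u"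
    and "\<And>k. \<exists>\<mu>. Hu *v u k = \<mu> *s u k"
    and "what \<in> range u"
    and "\<And>\<kappa>. \<kappa> > 0 \<Longrightarrow> orthonormal_basis (\<psi> \<kappa>)"
    and "\<And>\<kappa> j. \<kappa> > 0 \<Longrightarrow> H_total H Hu \<kappa> *v \<psi> \<kappa> j = complex_of_real (ev \<kappa> j) *s \<psi> \<kappa> j"
    and "\<And>j. ((\<lambda>\<kappa>. \<psi> \<kappa> j) \<longlongrightarrow> \<phi> j) at_top"
    and "\<And>j. w j \<in> range u"
    and "\<And>j. \<phi> j = (\<Sum>a\<in>UNIV. \<Sum>c\<in>UNIV. \<alpha> j a c *s (axis a 1 \<otimes>\<^sub>v w j \<otimes>\<^sub>v axis c 1))"
    and "\<forall>\<^sub>F \<kappa> in at_top. C1 (ev \<kappa>) \<inter> K1 w what \<inter> K2 \<phi> = {}"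
  shows "\<forall>\<epsilon>>0. \<exists>\<kappa>>0. \<forall>t \<rho>l \<rho>e. density_matrix \<rho>l \<longrightarrow> density_matrix \<rho>e \<longrightarrow>
    logical_purity (H_total H Hu \<kappa>) what \<rho>l \<rho>e t
      \<in> {logical_purity (H_total H Hu \<kappa>) what \<rho>l \<rho>e 0 - \<epsilon> <..<
         logical_purity (H_total H Hu \<kappa>) what \<rho>l \<rho>e 0 + \<epsilon>}"
proof (intro allI impI)
  fix \<epsilon> :: real
  assume "\<epsilon> > 0"
  \<comment> \<open>\<open>C1 (ev \<kappa>)\<close> may change with \<open>\<kappa>\<close>. This
    finite set is fixed and eventually contains it, so limits can be taken term by term.\<close>
  define B where "B = - (K1 w what \<inter> K2 \<phi>)"
  \<comment> \<open>Both \<open>what\<close> and \<open>w j\<close> belong to the orthonormal basis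
    \<open>u\<close>, so being distinct makes them orthogonal.\<close>
  have sw0: "sector_weight what (\<phi> j) = 0" if "w j \<noteq> what" for j
  proof -
    from assms(6,10) obtain k k' where "what = u k" "w j = u k'" by blast
    with that assms(4) have "cinner what (w j) = 0"
      by (auto simp: orthonormal_basis_def)
    then show ?thesis
      by (subst assms(11)) (rule sector_weight_product_zero)
  qed
  \<comment> \<open>A quadruple outside \<open>K1 w what\<close> has a vanishing weight; one outside
    \<open>K2 \<phi>\<close> has a vanishing swap element.\<close>
  have "coherence_bound what \<phi> J = 0" if "J \<in> B" for J
    using that sw0 by (cases J) (auto simp: B_def K1_def K2_def coherence_bound_def)
  then have "((\<lambda>\<kappa>. coherence_bound what (\<psi> \<kappa>) J) \<longlongrightarrow> 0) at_top" if "J \<in> B" for J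
    using tendsto_coherence_bound[of \<psi> \<phi> at_top what J, OF assms(9)] that by simp
  then have "((\<lambda>\<kappa>. 2 * (\<Sum>J\<in>B. coherence_bound what (\<psi> \<kappa>) J)) \<longlongrightarrow> 2 * (\<Sum>J\<in>B. 0)) at_top"
    by (intro tendsto_intros)
  then have "\<forall>\<^sub>F \<kappa> in at_top. 2 * (\<Sum>J\<in>B. coherence_bound what (\<psi> \<kappa>) J) < \<epsilon>"
    using \<open>\<epsilon> > 0\<close> by (intro order_tendstoD) simp_all
  \<comment> \<open>Positivity of \<open>\<kappa>\<close> is carried along because the eigenbasis is
    given only there.\<close>
  with assms(12) have "\<forall>\<^sub>F \<kappa> in at_top. \<kappa> > 0 \<and> C1 (ev \<kappa>) \<inter> K1 w what \<inter> K2 \<phi> = {} \<and>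
      2 * (\<Sum>J\<in>B. coherence_bound what (\<psi> \<kappa>) J) < \<epsilon>"
    by (intro eventually_conj eventually_gt_at_top)
  then obtain \<kappa> where \<kappa>: "\<kappa> > 0" "C1 (ev \<kappa>) \<subseteq> B"
      "2 * (\<Sum>J\<in>B. coherence_bound what (\<psi> \<kappa>) J) < \<epsilon>"
    unfolding B_def by (auto dest!: eventually_happens)
  have "(\<Sum>J\<in>C1 (ev \<kappa>). coherence_bound what (\<psi> \<kappa>) J) \<le> (\<Sum>J\<in>B. coherence_bound what (\<psi> \<kappa>) J)"
    by (intro sum_mono2 \<kappa>(2)) (simp_all add: coherence_bound_nonneg)
  \<comment> \<open>\<open>\<kappa>\<close> was fixed before time and states enter, so one choice
    serves all of them.\<close>
  then have "\<bar>logical_purity (H_total H Hu \<kappa>) what \<rho>l \<rho>e t - logical_purity (H_total H Hu \<kappa>) what \<rho>l \<rho>e 0\<bar> < \<epsilon>"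
    if "density_matrix \<rho>l" "density_matrix \<rho>e" for t \<rho>l \<rho>e
    using logical_purity_diff_bound[OF assms(7,8)[OF \<kappa>(1)] that, of what t] \<kappa>(3) by linarith
  with \<kappa>(1) show "\<exists>\<kappa>>0. \<forall>t \<rho>l \<rho>e. density_matrix \<rho>l \<longrightarrow> density_matrix \<rho>e \<longrightarrow>
    logical_purity (H_total H Hu \<kappa>) what \<rho>l \<rho>e t
      \<in> {logical_purity (H_total H Hu \<kappa>) what \<rho>l \<rho>e 0 - \<epsilon> <..<
         logical_purity (H_total H Hu \<kappa>) what \<rho>l \<rho>e 0 + \<epsilon>}"
    unfolding greaterThanLessThan_iff abs_less_iff by (smt (verit, best))
qed

end
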